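(* Let $r \in \mathbb{Q}_{>0}$, let $S = \{s_0 = 0 < s_1 < s_2 < \cdots\} \subseteq \mathbb{N}_0$ be infinite, and let $M_{r,S} = \langle r^{s_n} \mid n \in \mathbb{N}_0 \rangle$ be the additive submonoid of $\mathbb{Q}_{\geq 0}$ generated by the powers $r^{s_n}$. Then the following statements hold. (1) If $\mathsf{d}(r)=1$, then $M_{r,S} = \mathbb{N}_0$, and so $\mathcal{A}(M_{r,S}) = \{1\}$. (2) If $\mathsf{n}(r)=1$ and $\mathsf{d}(r)>1$, then $M_{r,S}$ is antimatter, and so $\mathcal{A}(M_{r,S}) = \emptyset$. (3) If $\mathsf{n}(r)>1$ and $\mathsf{d}(r)>1$, then $M_{r,S}$ is atomic and $\mathcal{A}(M_{r,S}) = \{r^s \mid s \in S\}$.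
   Context: For $r \in \mathbb{Q}_{>0}$ write $r = \mathsf{n}(r)/\mathsf{d}(r)$ with $\mathsf{n}(r), \mathsf{d}(r)$ relatively prime positive integers. For a commutative, cancellative, reduced additive monoid $M$ (reduced: $0$ is the only invertible element), $\mathcal{A}(M)$ denotes the set of atoms, i.e. the nonzero $a \in M$ such that $a = x+y$ with $x,y \in M$ implies $x = 0$ or $y = 0$. The monoid $M$ is atomic if $M$ is generated as a monoid by $\mathcal{A}(M)$, and antimatter if $\mathcal{A}(M) = \emptyset$. *)

theory Defs
  imports Complex_Main
begin

definition rnum :: "rat \<Rightarrow> nat" where
  "rnum r = nat (fst (quotient_of r))"

definition rden :: "rat \<Rightarrow> nat" where
  "rden r = nat (snd (quotient_of r))"

lemma rnum_rden:
  assumes "r > 0"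
  shows "rnum r > 0" "rden r > 0" "coprime (rnum r) (rden r)"
    "r = of_nat (rnum r) / of_nat (rden r)"
proof -
  obtain a b where ab: "quotient_of r = (a, b)"
    by (cases "quotient_of r")
  have b: "b > 0" and r: "r = of_int a / of_int b" and cop: "coprime a b"
    using quotient_of_denom_pos[OF ab] quotient_of_div[OF ab] quotient_of_coprime[OF ab]
    by auto
  have a: "a > 0"
    using assms b unfolding r by (simp add: zero_less_divide_iff)
  have n: "int (rnum r) = a" and d: "int (rden r) = b"
    using a b by (simp_all add: rnum_def rden_def ab)
  show "rnum r > 0" "rden r > 0"
    using a b n d by linarith+
  show "r = of_nat (rnum r) / of_nat (rden r)"
    using r by (simp flip: n d)
  show "coprime (rnum r) (rden r)"
    using cop n d by (metis coprime_int_iff)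
qed

definition add_submonoid :: "'a::cancel_comm_monoid_add set \<Rightarrow> bool" where
  "add_submonoid N \<longleftrightarrow> 0 \<in> N \<and> (\<forall>x\<in>N. \<forall>y\<in>N. x + y \<in> N)"

definition gen_monoid :: "'a::cancel_comm_monoid_add set \<Rightarrow> 'a set" where
  "gen_monoid X = add_submonoid hull X"

(* The next three notions are meant for sets M that are reduced submonoids of
   the ambient cancellative monoid. *)

definition atoms :: "'a::cancel_comm_monoid_add set \<Rightarrow> 'a set" where
  "atoms M = {a \<in> M. a \<noteq> 0 \<and> (\<forall>x\<in>M. \<forall>y\<in>M. a = x + y \<longrightarrow> x = 0 \<or> y = 0)}"

definition atomic_monoid :: "'a::cancel_comm_monoid_add set \<Rightarrow> bool" where
  "atomic_monoid M \<longleftrightarrow> M = gen_monoid (atoms M)"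

definition antimatter_monoid :: "'a::cancel_comm_monoid_add set \<Rightarrow> bool" where
  "antimatter_monoid M \<longleftrightarrow> atoms M = {}"

definition power_monoid :: "rat \<Rightarrow> (nat \<Rightarrow> nat) \<Rightarrow> rat set" where
  "power_monoid r s = gen_monoid {r ^ s n |n. True}"

lemma add_submonoid_gen_monoid: "add_submonoid (gen_monoid X)"
  unfolding gen_monoid_def by (rule hull_in) (auto simp: add_submonoid_def)

(* Hence it makes no difference whether the generated submonoid is formed in
   the rationals or in the nonnegative rationals, and it is reduced. *)
lemma power_monoid_nonneg:
  assumes "r > 0"
  shows "power_monoid r s \<subseteq> {0..}"
  unfolding power_monoid_def gen_monoid_def
  by (rule hull_minimal) (use assms in \<open>auto simp: add_submonoid_def\<close>)

end

theory Submission
  imports Defs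
begin

text \<open>
  An atom of a generated monoid is one of the generators. Conversely, for positive generators,
  a generator \<open>p\<close> is an atom as soon as it is not generated by the smaller generators. If
  \<open>r = a / b > 1\<close>, the powers below \<open>r ^ k\<close> have denominators dividing \<open>b ^ (k - 1)\<close>, whereas
  the denominator \<open>b ^ k\<close> of \<open>r ^ k\<close> does not divide it; if \<open>r < 1\<close>, the powers below \<open>r ^ k\<close> have numerators divisible
  by \<open>a ^ (k + 1)\<close>, whereas that of \<open>r ^ k\<close> is not.
\<close>

lemma gen_monoid_superset: "X \<subseteq> gen_monoid X"
  unfolding gen_monoid_def by (rule hull_subset)

lemma gen_monoid_minimal: "X \<subseteq> N \<Longrightarrow> add_submonoid N \<Longrightarrow> gen_monoid X \<subseteq> N"
  unfolding gen_monoid_def by (rule hull_minimal)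

lemma gen_monoid_mono: "X \<subseteq> Y \<Longrightarrow> gen_monoid X \<subseteq> gen_monoid Y"
  unfolding gen_monoid_def by (rule hull_mono)

lemma gen_monoid_zero: "0 \<in> gen_monoid X"
  using add_submonoid_gen_monoid[of X] by (simp add: add_submonoid_def)

lemma gen_monoid_empty: "gen_monoid {} = {0}"
  using gen_monoid_minimal[of "{}" "{0}"] gen_monoid_zero[of "{}"]
  by (auto simp: add_submonoid_def)

lemma gen_monoid_add: "x \<in> gen_monoid X \<Longrightarrow> y \<in> gen_monoid X \<Longrightarrow> x + y \<in> gen_monoid X"
  using add_submonoid_gen_monoid[of X] by (simp add: add_submonoid_def)

lemma gen_monoid_of_nat_mult:
  fixes x :: "'a::{cancel_comm_monoid_add, semiring_1}"
  assumes "x \<in> gen_monoid X"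
  shows "of_nat n * x \<in> gen_monoid X"
  by (induction n) (auto simp: gen_monoid_zero distrib_right intro: gen_monoid_add assms)

text \<open>A sum of two nonzero elements of the monoid is never an atom. So discarding the atoms
  that are not generators leaves a submonoid \<open>?N\<close> that still contains
  \<open>X\<close>.\<close>

lemma atoms_gen_monoid_subset: "atoms (gen_monoid X) \<subseteq> X"
proof -
  let ?N = "{x \<in> gen_monoid X. x = 0 \<or> x \<in> X \<or> x \<notin> atoms (gen_monoid X)}"
  have "gen_monoid X \<subseteq> ?N"
  proof (rule gen_monoid_minimal)
    show "X \<subseteq> ?N" using gen_monoid_superset by auto
    have "x + y \<in> ?N" if "x \<in> ?N" "y \<in> ?N" for x y
      using that by (cases "x = 0"; cases "y = 0") (auto simp: atoms_def gen_monoid_add)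
    then show "add_submonoid ?N"
      unfolding add_submonoid_def by (simp add: gen_monoid_zero)
  qed
  then show ?thesis by (auto simp: atoms_def)
qed

lemma gen_monoid_nonneg:
  fixes X :: "'a::linordered_ab_group_add set"
  assumes "\<And>q. q \<in> X \<Longrightarrow> 0 < q"
  shows "gen_monoid X \<subseteq> {0..}"
  by (rule gen_monoid_minimal) (use assms in \<open>auto simp: add_submonoid_def less_imp_le\<close>)

text \<open>Nonnegative summands never exceed their sum, so an element below \<open>p\<close> can
  only involve generators below \<open>p\<close>. Keeping \<open>0 \<le> x\<close> in the invariant
  \<open>?N\<close> ensures that a sum stays at least \<open>p\<close> once one summand is.\<close>

lemma gen_monoid_less:
  fixes X :: "'a::linordered_ab_group_add set"
  assumes pos: "\<And>q. q \<in> X \<Longrightarrow> 0 < q" and "x \<in> gen_monoid X" "x < p"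
  shows "x \<in> gen_monoid {q \<in> X. q < p}"
proof -
  let ?G = "gen_monoid {q \<in> X. q < p}"
  let ?N = "{x. 0 \<le> x \<and> (p \<le> x \<or> x \<in> ?G)}"
  have "gen_monoid X \<subseteq> ?N"
  proof (rule gen_monoid_minimal)
    show "X \<subseteq> ?N"
      using pos gen_monoid_superset[of "{q \<in> X. q < p}"] by (auto simp: less_imp_le not_le)
    have "x + y \<in> ?N" if "x \<in> ?N" "y \<in> ?N" for x y
      using that by (auto simp: gen_monoid_add add_increasing add_increasing2)
    then show "add_submonoid ?N"
      unfolding add_submonoid_def by (simp add: gen_monoid_zero)
  qed
  with assms show ?thesis by auto
qed

text \<open>In a splitting of \<open>p\<close> into nonzero summands both are positive, hence both
  lie below \<open>p\<close>. Then both, and so \<open>p\<close> itself, are generated by the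
  generators below \<open>p\<close>.\<close>

lemma generator_in_atoms:
  fixes X :: "'a::linordered_ab_group_add set"
  assumes pos: "\<And>q. q \<in> X \<Longrightarrow> 0 < q" and "p \<in> X" "p \<notin> gen_monoid {q \<in> X. q < p}"
  shows "p \<in> atoms (gen_monoid X)"
proof -
  have "x = 0 \<or> y = 0" if xy: "x \<in> gen_monoid X" "y \<in> gen_monoid X" "p = x + y" for x y
  proof (rule ccontr)
    assume "\<not> (x = 0 \<or> y = 0)"
    then have "0 < x" "0 < y"
      using gen_monoid_nonneg[of X, OF pos] xy(1,2) by (auto simp: less_le)
    then have "x < p" "y < p"
      using xy(3) by simp_all
    then have "p \<in> gen_monoid {q \<in> X. q < p}"
      unfolding xy(3) using xy(1,2)
      by (intro gen_monoid_add gen_monoid_less pos)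
    with assms show False by simp
  qed
  moreover have "p \<in> gen_monoid X" "p \<noteq> 0"
    using gen_monoid_superset[of X] pos[OF \<open>p \<in> X\<close>] \<open>p \<in> X\<close> by auto
  ultimately show ?thesis
    unfolding atoms_def by blast
qed

lemma power_notin_gen_smaller_powers:
  fixes a b :: nat
  assumes "1 < a" "1 < b" "coprime a b" and r: "r = (of_nat a / of_nat b :: rat)"
    and X: "X \<subseteq> range ((^) r)"
  shows "r ^ k \<notin> gen_monoid {q \<in> X. q < r ^ k}"
proof
  assume mem: "r ^ k \<in> gen_monoid {q \<in> X. q < r ^ k}"
  have r0: "0 < r" using assms by simp
  \<comment> \<open>\<open>r = 1\<close> would mean \<open>a = b\<close>, impossible for coprime
    numbers above 1.\<close>
  consider "r > 1" | "r < 1"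
    using assms by (cases r "1 :: rat" rule: linorder_cases) auto
  then show False
  proof cases
    case 1
    \<comment> \<open>These are the rationals with denominator dividing \<open>b ^ (k - 1)\<close>.
      As \<open>r > 1\<close>, smaller powers have smaller exponents.\<close>
    let ?N = "{x. of_nat b ^ (k - 1) * x \<in> (\<int> :: rat set)}"
    have "gen_monoid {q \<in> X. q < r ^ k} \<subseteq> ?N"
    proof (rule gen_monoid_minimal)
      show "{q \<in> X. q < r ^ k} \<subseteq> ?N"
      proof clarify
        fix q assume "q \<in> X" "q < r ^ k"
        with X obtain j where q: "q = r ^ j" by auto
        with \<open>q < r ^ k\<close> 1 have "j \<le> k - 1"
          by (simp add: power_strict_increasing_iff)
        then have "of_nat b ^ (k - 1) * q = (of_nat (b ^ (k - 1 - j) * a ^ j) :: rat)"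
          using assms unfolding q r by (simp add: field_simps flip: power_add)
        then show "of_nat b ^ (k - 1) * q \<in> (\<int> :: rat set)"
          by (metis Ints_of_nat)
      qed
      show "add_submonoid ?N"
        by (auto simp: add_submonoid_def distrib_left)
    qed
    with mem have int: "of_nat b ^ (k - 1) * r ^ k \<in> (\<int> :: rat set)" by auto
    \<comment> \<open>Since \<open>k - 1\<close> truncates, integrality yields no contradiction for
      \<open>k = 0\<close>. Instead, no power of \<open>r\<close> lies below 1, so only 0 is
      generated.\<close>
    have "k \<noteq> 0"
    proof
      assume "k = 0"
      then have "{q \<in> X. q < r ^ k} = {}"
        using 1 X by (auto simp: power_less_one_iff not_less one_le_power)
      with mem \<open>k = 0\<close> show False
        by (simp only: gen_monoid_empty) simp
    qed
    then have eq: "of_nat b ^ (k - 1) * r ^ k = (of_nat (a ^ k) / of_nat b :: rat)"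
      using assms unfolding r by (cases k) (simp_all add: field_simps)
    from int obtain z where "of_nat b ^ (k - 1) * r ^ k = of_int z"
      by (elim Ints_cases)
    with eq have "of_nat (a ^ k) / of_nat b = (of_int z :: rat)" by simp
    then have "(of_nat (a ^ k) :: rat) = of_int (z * int b)"
      using \<open>1 < b\<close> by (simp add: field_simps)
    then have "int (a ^ k) = z * int b"
      by (metis of_int_eq_iff of_int_of_nat_eq)
    then have "b dvd a ^ k"
      by (metis dvd_triv_right int_dvd_int_iff)
    moreover have "coprime b (a ^ k)"
      using assms by (simp add: coprime_commute)
    ultimately have "is_unit b"
      using coprime_absorb_left by blast
    with assms show False by simp
  next
    case 2
    \<comment> \<open>As \<open>r < 1\<close>, smaller powers have exponents at least
      \<open>Suc k\<close>. These are not bounded above, so the power of \<open>b\<close> that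
      clears the denominator must depend on \<open>x\<close>.\<close>
    let ?N = "{x :: rat. \<exists>n m. of_nat b ^ n * x = of_nat (a ^ Suc k * m)}"
    have "gen_monoid {q \<in> X. q < r ^ k} \<subseteq> ?N"
    proof (rule gen_monoid_minimal)
      show "{q \<in> X. q < r ^ k} \<subseteq> ?N"
      proof clarify
        fix q assume "q \<in> X" "q < r ^ k"
        with X obtain j where q: "q = r ^ j" by auto
        with \<open>q < r ^ k\<close> 2 r0 have "Suc k \<le> j"
          by (simp add: power_strict_decreasing_iff)
        then have "a ^ j = a ^ Suc k * a ^ (j - Suc k)"
          by (metis le_add_diff_inverse power_add)
        moreover have "of_nat b ^ j * q = (of_nat (a ^ j) :: rat)"
          using assms unfolding q r by (simp add: field_simps)
        ultimately show "\<exists>n m. of_nat b ^ n * q = of_nat (a ^ Suc k * m)"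
          by metis
      qed
      have "x + y \<in> ?N" if "x \<in> ?N" "y \<in> ?N" for x y
      proof -
        from that obtain n m n' m' where
          x: "of_nat b ^ n * x = of_nat (a ^ Suc k * m)" and
          y: "of_nat b ^ n' * y = of_nat (a ^ Suc k * m')" by auto
        have "of_nat b ^ (n + n') * (x + y)
            = of_nat b ^ n' * (of_nat b ^ n * x) + of_nat b ^ n * (of_nat b ^ n' * y)"
          by (simp add: power_add algebra_simps)
        also have "\<dots> = of_nat (a ^ Suc k * (b ^ n' * m + b ^ n * m'))"
          unfolding x y by (simp add: algebra_simps)
        finally show ?thesis by blast
      qed
      then show "add_submonoid ?N"
        unfolding add_submonoid_def by (auto intro!: exI[of _ 0])
    qed
    with mem obtain n m where "of_nat b ^ n * r ^ k = (of_nat (a ^ Suc k * m) :: rat)"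
      by auto
    \<comment> \<open>Cancelling \<open>a ^ k\<close> leaves one factor \<open>a\<close>, which then
      divides a power of \<open>b\<close>.\<close>
    then have "of_nat (b ^ n) = (of_nat (a * m * b ^ k) :: rat)"
      using assms unfolding r by (simp add: field_simps)
    then have "b ^ n = a * m * b ^ k"
      by (simp only: of_nat_eq_iff)
    then have "a dvd b ^ n" by simp
    moreover have "coprime a (b ^ n)"
      using assms by simp
    ultimately have "is_unit a"
      using coprime_absorb_left by blast
    with assms show False by simp
  qed
qed

lemma Nats_eq_gen_monoid: "(\<nat> :: 'a::{cancel_comm_monoid_add, semiring_1} set) = gen_monoid {1}"
proof
  show "\<nat> \<subseteq> gen_monoid {1 :: 'a}"
    using gen_monoid_of_nat_mult[of 1 "{1 :: 'a}"] gen_monoid_superset[of "{1 :: 'a}"]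
    by (auto elim!: Nats_cases)
  show "gen_monoid {1 :: 'a} \<subseteq> \<nat>"
    by (rule gen_monoid_minimal) (auto simp: add_submonoid_def)
qed

lemma atoms_Nats: "atoms \<nat> = {1 :: rat}"
proof -
  \<comment> \<open>With no generator below 1, \<open>generator_in_atoms\<close> only asks that 1
    differ from 0.\<close>
  have "{q \<in> {1 :: rat}. q < 1} = {}" by auto
  then have "(1 :: rat) \<in> atoms (gen_monoid {1})"
    by (intro generator_in_atoms) (simp_all only: gen_monoid_empty, simp_all)
  then show ?thesis
    using atoms_gen_monoid_subset[of "{1 :: rat}"] unfolding Nats_eq_gen_monoid by auto
qed

lemma power_monoid_eq_Nats:
  assumes "s 0 = 0" "r \<in> \<nat>"
  shows "power_monoid r s = \<nat>"
proof
  show "power_monoid r s \<subseteq> \<nat>"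
    unfolding power_monoid_def
    by (rule gen_monoid_minimal)
      (use assms(2) in \<open>auto simp: add_submonoid_def elim!: Nats_cases simp flip: of_nat_power\<close>)
  \<comment> \<open>The exponent 0 puts 1 among the generators, which yields all of
    \<open>\<nat>\<close>.\<close>
  have "1 = r ^ s 0" using assms by simp
  then show "\<nat> \<subseteq> power_monoid r s"
    unfolding power_monoid_def Nats_eq_gen_monoid by (intro gen_monoid_mono) blast
qed

text \<open>Only generators can be atoms, and each generator is a multiple of the next one, with
  factor \<open>d\<close> raised to the gap between the exponents.\<close>

lemma atoms_power_monoid_inverse:
  fixes d :: nat
  assumes "strict_mono s" "1 < d" and r: "r = (1 / of_nat d :: rat)"
  shows "atoms (power_monoid r s) = {}"
proof -
  have "r ^ s n \<notin> atoms (power_monoid r s)" for n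
  proof
    assume atom: "r ^ s n \<in> atoms (power_monoid r s)"
    let ?q = "r ^ s (Suc n)" and ?D = "d ^ (s (Suc n) - s n)"
    have less: "s n < s (Suc n)"
      using assms(1) by (simp add: strict_mono_def)
    then have D: "1 < ?D"
      using assms(2) by (intro one_less_power) simp_all
    have "r ^ s n = of_nat ?D * ?q"
      using assms less unfolding r by (simp add: field_simps flip: power_add)
    \<comment> \<open>One copy of \<open>?q\<close> is split off. Because \<open>?D > 1\<close>, the
      remainder is nonzero and the splitting is proper.\<close>
    also have "\<dots> = ?q + of_nat (?D - 1) * ?q"
      using D by (simp add: of_nat_diff algebra_simps)
    finally have eq: "r ^ s n = ?q + of_nat (?D - 1) * ?q" .
    have q: "?q \<in> power_monoid r s"
      unfolding power_monoid_def by (rule subsetD[OF gen_monoid_superset]) blast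
    then have "of_nat (?D - 1) * ?q \<in> power_monoid r s"
      unfolding power_monoid_def by (rule gen_monoid_of_nat_mult)
    with atom q eq have "?q = 0 \<or> of_nat (?D - 1) * ?q = 0"
      unfolding atoms_def by blast
    moreover have "?q \<noteq> 0" using assms by simp
    moreover have "(of_nat (?D - 1) :: rat) \<noteq> 0"
      using D by (simp only: of_nat_eq_0_iff)
    ultimately show False by (metis mult_eq_0_iff)
  qed
  then show ?thesis
    using atoms_gen_monoid_subset[of "{r ^ s n |n. True}"] unfolding power_monoid_def by blast
qed

lemma atoms_power_monoid:
  assumes "r > 0" "1 < rnum r" "1 < rden r"
  shows "atoms (power_monoid r s) = {r ^ s n |n. True}"
proof -
  let ?X = "{r ^ s n |n. True}"
  have "r ^ s n \<in> atoms (gen_monoid ?X)" for n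
  proof (rule generator_in_atoms)
    show "r ^ s n \<notin> gen_monoid {q \<in> ?X. q < r ^ s n}"
      by (rule power_notin_gen_smaller_powers[OF assms(2,3) rnum_rden(3,4)[OF assms(1)]]) auto
  qed (use assms in auto)
  then show ?thesis
    using atoms_gen_monoid_subset[of ?X] unfolding power_monoid_def by auto
qed

theorem proposition3p7:
  fixes r :: rat and S :: "nat set" and s :: "nat \<Rightarrow> nat" and M :: "rat set"
  assumes "r > 0"
    and "s 0 = 0" and "strict_mono s" and "S = range s"
    and "M = power_monoid r s"
  shows "(rden r = 1 \<longrightarrow> M = \<nat> \<and> atoms M = {1})
    \<and> (rnum r = 1 \<and> rden r > 1 \<longrightarrow> antimatter_monoid M \<and> atoms M = {})
    \<and> (rnum r > 1 \<and> rden r > 1 \<longrightarrow> atomic_monoid M \<and> atoms M = {r ^ k |k. k \<in> S})"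
proof (intro conjI impI; (elim conjE)?)
  note r = rnum_rden(4)[OF assms(1)]
  show Nats: "M = \<nat>" if "rden r = 1"
  proof -
    have "r = of_nat (rnum r)"
      using r that by (metis div_by_1 of_nat_1)
    then have "r \<in> \<nat>"
      by (metis of_nat_in_Nats)
    with assms show ?thesis
      by (simp add: power_monoid_eq_Nats)
  qed
  show "atoms M = {1}" if "rden r = 1"
    using Nats[OF that] atoms_Nats by simp
  show "atoms M = {}" if "rnum r = 1" "1 < rden r"
  proof -
    have "r = 1 / of_nat (rden r)"
      using r that(1) by (metis of_nat_1)
    with assms(3) that(2) show ?thesis
      unfolding assms(5) by (rule atoms_power_monoid_inverse)
  qed
  then show "antimatter_monoid M" if "rnum r = 1" "1 < rden r"
    using that by (simp add: antimatter_monoid_def)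
  have atoms: "atoms M = {r ^ s n |n. True}" if "1 < rnum r" "1 < rden r"
    unfolding assms(5) using assms(1) that by (rule atoms_power_monoid)
  show "atoms M = {r ^ k |k. k \<in> S}" if "1 < rnum r" "1 < rden r"
    using atoms[OF that] assms(4) by auto
  \<comment> \<open>The atoms are exactly the defining generators, so they generate
    \<open>M\<close>.\<close>
  show "atomic_monoid M" if "1 < rnum r" "1 < rden r"
    unfolding atomic_monoid_def atoms[OF that] by (simp add: assms(5) power_monoid_def)
qed

end
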